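(* Let $\mathcal P$ be the feasible region of the full ordered-unit formulation (with the Big-$M$ constants given in the context), and let $X^{\mathrm{ord}}=\{\bar x\in X^{\mathrm{net}}:\Omega(\bar x)\ne\emptyset\}$. Then $$\operatorname{proj}_x(\mathcal P)=X^{\mathrm{ord}}.$$ Consequently, an integral assignment $\bar x\in X^{\mathrm{net}}$ is the $x$-projection of a feasible solution $(\bar x,y,\theta,u)\in\mathcal P$ of the full formulation if and only if it admits at least one blockage-free ordering witness, i.e. $\Omega(\bar x)\neq\emptyset$.
   Context: **Network.** $\tilde N$ is a finite set of trips; $0,\infty$ are an artificial source and sink; $N=\tilde N\cup\{0,\infty\}$. The finite arc set is $A=\tilde A\cup\{(0,j):j\in\tilde N\}\cup\{(j,\infty):j\in\tilde N\}$, where $\tilde A\subseteq\tilde N\times\tilde N$ is the set of turn-round arcs, and $(N,A)$ is a directed acyclic graph. $T$ is a finite set of unit types; $H_t$ is the finite set of individual units of type $t$, $b^t=|H_t|$, $H=\bigsqcup_{t\in T}H_t$. A family $f\in F$ is a set of types with size limit $v^f\in\mathbb Z_{\ge1}$; $F_j\subseteq F$ is the nonempty set of families feasible for trip $j$. Each unit $h$ has a feasible arc set $A^h\subseteq A$; an arc of $A^h$ may touch trip $j$ only if the type of $h$ belongs to some $f\in F_j$. $\delta_+^h(i)$, $\delta_-^h(i)$ are the arcs of $A^h$ leaving, respectively entering, node $i$. Each trip $i$ has a direction $d_i\in\{-1,1\}$ and arrival/departure times $\tau_i^{arr},\tau_i^{dep}$; times that are compared in same-direction coupling/decoupling instances are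 assumed distinct. $\kappa^t$ is the capacity of type $t$, $r_j$ the demand of trip $j$. **Network constraints**, in binary variables $x_a^h$ ($h\in H,a\in A^h$) and $y_j^f$ ($j\in\tilde N,f\in F_j$): $\sum_{a\in\delta_+^h(0)}x_a^h\le1$ for all $h$; $\sum_{a\in\delta_+^h(j)}x_a^h=\sum_{a\in\delta_-^h(j)}x_a^h$ for all $h$ and $j\in\tilde N$; $\sum_{h\in H_t}\sum_{a\in\delta_+^h(0)}x_a^h\le b^t$ for all $t$; $\sum_t\sum_{h\in H_t}\sum_{a\in\delta_+^h(j)}\kappa^tx_a^h\ge r_j$ for all $j\in\tilde N$; $\sum_{t\in f}\sum_{h\in H_t}\sum_{a\in\delta_+^h(j)}x_a^h\le v^fy_j^f$ for all $j\in\tilde N,f\in F_j$; $\sum_{f\in F_j}y_j^f=1$ for all $j\in\tilde N$. Let $\mathcal N$ be the set of binary $(x,y)$ satisfying these and $X^{\mathrm{net}}=\operatorname{proj}_x(\mathcal N)$. **Notation.** $s_i^h=\sum_{a\in\delta_+^h(i)}x_a^h$, $q_i=\sum_{h\in H}s_i^h$, $\bar q_i=\max_{f\in F_i}v^f$, $M_i=\bar q_i$. **Order-linking constraints**, in variables $\theta_i^h\in\{0,1,\dots,\bar q_i\}$ and $u_i^{h_1h_2}\in\{0,1\}$ ($i\in\tilde N$, $h,h_1\ne h_2\in H$): $s_i^h\le\theta_i^h\le q_i$; $\theta_i^h\le M_is_i^h$; and $1-M_i(1-u_i^{h_1h_2})-M_i(2-s_i^{h_1}-s_i^{h_2})\le\theta_i^{h_1}-\theta_i^{h_2}\le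 M_iu_i^{h_1h_2}-1+M_i(2-s_i^{h_1}-s_i^{h_2})$. **Ordering instances** (for all distinct $h_1,h_2\in H$). (If the input data mark some station events or arcs as permitting shunting/resequencing, the corresponding instances are removed from the model throughout.) - Coupling, for $a_1=(i_1,j)\in A^{h_1}\cap\tilde A$, $a_2=(i_2,j)\in A^{h_2}\cap\tilde A$, with $D=2-x_{a_1}^{h_1}-x_{a_2}^{h_2}$: $d_j(d_{i_1}-d_{i_2})(\theta_j^{h_1}-\theta_j^{h_2})\ge-2\bar q_jD$, and $c\,(\theta_j^{h_1}-\theta_j^{h_2})\ge-|c|\bar q_jD$ where $c=d_j(d_{i_1}+d_{i_2})(\tau_{i_1}^{arr}-\tau_{i_2}^{arr})$. - Decoupling, for $a_1=(i,j_1)\in A^{h_1}\cap\tilde A$, $a_2=(i,j_2)\in A^{h_2}\cap\tilde A$, with $D=2-x_{a_1}^{h_1}-x_{a_2}^{h_2}$: $d_i(d_{j_1}-d_{j_2})(\theta_i^{h_1}-\theta_i^{h_2})\le2\bar q_iD$, and $c\,(\theta_i^{h_1}-\theta_i^{h_2})\ge-|c|\bar q_iD$ where $c=d_i(d_{j_1}+d_{j_2})(\tau_{j_1}^{dep}-\tau_{j_2}^{dep})$. - Continuation, for $a=(i,j)\in\tilde A\cap A^{h_1}\cap A^{h_2}$: $-M^{\mathrm{cont}}_{ij}D\le(\theta_j^{h_1}-\theta_j^{h_2})-d_id_j(\theta_i^{h_1}-\theta_i^{h_2})\le M^{\mathrm{cont}}_{ij}D$ with $D=2-x_a^{h_1}-x_a^{h_2}$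 and $M^{\mathrm{cont}}_{ij}=2\max\{\bar q_i,\bar q_j,1\}$. An instance is *active* under $\bar x$ if $D=0$ at $x=\bar x$. $L(\bar x)$ denotes the set of instances active under $\bar x$. **Full formulation.** $\mathcal P$ is the set of $(x,y,\theta,u)$ satisfying the network constraints, the order-linking constraints, all ordering instances, and all integrality/domain requirements above. **Ordering completions.** For $\bar x\in X^{\mathrm{net}}$, $\Omega(\bar x)$ is the set of $(\theta,u)$ satisfying (with $x=\bar x$) the order-linking constraints, including the domains of $\theta,u$, and all instances in $L(\bar x)$. An element of $\Omega(\bar x)$ is called a blockage-free ordering witness for $\bar x$. *)

theory Defs
  imports Complex_Main "HOL-Library.FuncSet"
begin

datatype 'j node = Source | Sink | Trip 'j

type_synonym 'j arc = "'j node \<times> 'j node"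

text \<open>
  Index tuples of the ordering instances: \<open>Coupling h1 h2 i1 i2 j\<close> belongs to the arcs
  \<open>(i1, j)\<close> of \<open>h1\<close> and \<open>(i2, j)\<close> of \<open>h2\<close>, \<open>Decoupling h1 h2 i j1 j2\<close> to \<open>(i, j1)\<close> of \<open>h1\<close>
  and \<open>(i, j2)\<close> of \<open>h2\<close>, and \<open>Continuation h1 h2 i j\<close> to the common arc \<open>(i, j)\<close>.
\<close>

datatype ('j, 'h) ordering_inst =
    Coupling 'h 'h 'j 'j 'j
  | Decoupling 'h 'h 'j 'j 'j
  | Continuation 'h 'h 'j 'j

text \<open>
  A family is literally a set of types. The field \<open>shunted\<close> collects the ordering instances
  that are removed because the input marks the corresponding station event or arc as
  permitting shunting or resequencing. It is an arbitrary set, so that any way of marking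
  events and arcs is covered; the empty set means that nothing is marked.
\<close>

record ('j, 't, 'h) rolling_data =
  trips :: "'j set"
  turns :: "('j \<times> 'j) set"
  utypes :: "'t set"
  units :: "'h set"
  type_of :: "'h \<Rightarrow> 't"
  families :: "'t set set"
  size_limit :: "'t set \<Rightarrow> int"
  trip_families :: "'j \<Rightarrow> 't set set"
  unit_arcs :: "'h \<Rightarrow> 'j arc set"
  dir :: "'j \<Rightarrow> int"
  arr_time :: "'j \<Rightarrow> real"
  dep_time :: "'j \<Rightarrow> real"
  capacity :: "'t \<Rightarrow> real"
  demand :: "'j \<Rightarrow> real"
  shunted :: "('j, 'h) ordering_inst set"

definition arcs :: "('j, 't, 'h) rolling_data \<Rightarrow> 'j arc set" where
  "arcs R = {(Trip i, Trip j) | i j. (i, j) \<in> turns R}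
     \<union> {(Source, Trip j) | j. j \<in> trips R} \<union> {(Trip j, Sink) | j. j \<in> trips R}"

definition units_of_type :: "('j, 't, 'h) rolling_data \<Rightarrow> 't \<Rightarrow> 'h set" where
  "units_of_type R t = {h \<in> units R. type_of R h = t}"

definition num_units :: "('j, 't, 'h) rolling_data \<Rightarrow> 't \<Rightarrow> int" where
  "num_units R t = int (card (units_of_type R t))"

definition out_arcs :: "('j, 't, 'h) rolling_data \<Rightarrow> 'h \<Rightarrow> 'j node \<Rightarrow> 'j arc set" where
  "out_arcs R h n = {a \<in> unit_arcs R h. fst a = n}"

definition in_arcs :: "('j, 't, 'h) rolling_data \<Rightarrow> 'h \<Rightarrow> 'j node \<Rightarrow> 'j arc set" where
  "in_arcs R h n = {a \<in> unit_arcs R h. snd a = n}"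

text \<open>The turn-round arc \<open>(i, j)\<close> is available to unit \<open>h\<close>.\<close>

definition unit_turn :: "('j, 't, 'h) rolling_data \<Rightarrow> 'h \<Rightarrow> 'j \<Rightarrow> 'j \<Rightarrow> bool" where
  "unit_turn R h i j \<longleftrightarrow> (i, j) \<in> turns R \<and> (Trip i, Trip j) \<in> unit_arcs R h"

fun admissible_inst :: "('j, 't, 'h) rolling_data \<Rightarrow> ('j, 'h) ordering_inst \<Rightarrow> bool" where
  "admissible_inst R (Coupling h1 h2 i1 i2 j) \<longleftrightarrow>
     h1 \<in> units R \<and> h2 \<in> units R \<and> h1 \<noteq> h2 \<and> unit_turn R h1 i1 j \<and> unit_turn R h2 i2 j"
| "admissible_inst R (Decoupling h1 h2 i j1 j2) \<longleftrightarrow>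
     h1 \<in> units R \<and> h2 \<in> units R \<and> h1 \<noteq> h2 \<and> unit_turn R h1 i j1 \<and> unit_turn R h2 i j2"
| "admissible_inst R (Continuation h1 h2 i j) \<longleftrightarrow>
     h1 \<in> units R \<and> h2 \<in> units R \<and> h1 \<noteq> h2 \<and> unit_turn R h1 i j \<and> unit_turn R h2 i j"

definition ordering_insts :: "('j, 't, 'h) rolling_data \<Rightarrow> ('j, 'h) ordering_inst set" where
  "ordering_insts R = {k. admissible_inst R k} - shunted R"

text \<open>
  In the last two conditions the two compared trips are required to be different: an
  instance whose two arcs coincide compares a time with itself, and its constraints are
  trivial.
\<close>

definition valid_data :: "('j, 't, 'h) rolling_data \<Rightarrow> bool" where
  "valid_data R \<longleftrightarrow>
     finite (trips R) \<and> turns R \<subseteq> trips R \<times> trips R \<and> acyclic (arcs R) \<and>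
     finite (utypes R) \<and> finite (units R) \<and> type_of R ` units R \<subseteq> utypes R \<and>
     families R \<subseteq> Pow (utypes R) \<and> (\<forall>f\<in>families R. 1 \<le> size_limit R f) \<and>
     (\<forall>j\<in>trips R. trip_families R j \<subseteq> families R \<and> trip_families R j \<noteq> {}) \<and>
     (\<forall>h\<in>units R. unit_arcs R h \<subseteq> arcs R) \<and>
     (\<forall>h\<in>units R. \<forall>a\<in>unit_arcs R h. \<forall>j\<in>trips R.
        fst a = Trip j \<or> snd a = Trip j \<longrightarrow> (\<exists>f\<in>trip_families R j. type_of R h \<in> f)) \<and>
     (\<forall>i\<in>trips R. dir R i \<in> {-1, 1}) \<and>
     (\<forall>h1 h2 i1 i2 j. Coupling h1 h2 i1 i2 j \<in> ordering_insts R \<and> i1 \<noteq> i2 \<and>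
        dir R i1 = dir R i2 \<longrightarrow> arr_time R i1 \<noteq> arr_time R i2) \<and>
     (\<forall>h1 h2 i j1 j2. Decoupling h1 h2 i j1 j2 \<in> ordering_insts R \<and> j1 \<noteq> j2 \<and>
        dir R j1 = dir R j2 \<longrightarrow> dep_time R j1 \<noteq> dep_time R j2)"

text \<open>
  Variables are extensional functions on their index sets, so that a vector is determined
  by its components and projections are sets of vectors.
\<close>

type_synonym ('j, 'h) xvar = "'h \<times> 'j arc \<Rightarrow> int"
type_synonym ('j, 't) yvar = "'j \<times> 't set \<Rightarrow> int"
type_synonym ('j, 'h) thvar = "'j \<times> 'h \<Rightarrow> int"
type_synonym ('j, 'h) uvar = "'j \<times> 'h \<times> 'h \<Rightarrow> int"

definition x_dom :: "('j, 't, 'h) rolling_data \<Rightarrow> ('j, 'h) xvar set" where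
  "x_dom R = (SIGMA h:units R. unit_arcs R h) \<rightarrow>\<^sub>E {0, 1}"

definition y_dom :: "('j, 't, 'h) rolling_data \<Rightarrow> ('j, 't) yvar set" where
  "y_dom R = (SIGMA j:trips R. trip_families R j) \<rightarrow>\<^sub>E {0, 1}"

definition network_feasible :: "('j, 't, 'h) rolling_data \<Rightarrow> (('j, 'h) xvar \<times> ('j, 't) yvar) set" where
  "network_feasible R = {(x, y). x \<in> x_dom R \<and> y \<in> y_dom R \<and>
     (\<forall>h\<in>units R. (\<Sum>a\<in>out_arcs R h Source. x (h, a)) \<le> 1) \<and>
     (\<forall>h\<in>units R. \<forall>j\<in>trips R.
        (\<Sum>a\<in>out_arcs R h (Trip j). x (h, a)) = (\<Sum>a\<in>in_arcs R h (Trip j). x (h, a))) \<and>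
     (\<forall>t\<in>utypes R.
        (\<Sum>h\<in>units_of_type R t. \<Sum>a\<in>out_arcs R h Source. x (h, a)) \<le> num_units R t) \<and>
     (\<forall>j\<in>trips R.
        (\<Sum>t\<in>utypes R. \<Sum>h\<in>units_of_type R t. \<Sum>a\<in>out_arcs R h (Trip j).
           capacity R t * of_int (x (h, a))) \<ge> demand R j) \<and>
     (\<forall>j\<in>trips R. \<forall>f\<in>trip_families R j.
        (\<Sum>t\<in>f. \<Sum>h\<in>units_of_type R t. \<Sum>a\<in>out_arcs R h (Trip j). x (h, a))
          \<le> size_limit R f * y (j, f)) \<and>
     (\<forall>j\<in>trips R. (\<Sum>f\<in>trip_families R j. y (j, f)) = 1)}"

definition X_net :: "('j, 't, 'h) rolling_data \<Rightarrow> ('j, 'h) xvar set" where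
  "X_net R = fst ` network_feasible R"

definition serves :: "('j, 't, 'h) rolling_data \<Rightarrow> ('j, 'h) xvar \<Rightarrow> 'j \<Rightarrow> 'h \<Rightarrow> int" where
  "serves R x i h = (\<Sum>a\<in>out_arcs R h (Trip i). x (h, a))"

definition qty :: "('j, 't, 'h) rolling_data \<Rightarrow> ('j, 'h) xvar \<Rightarrow> 'j \<Rightarrow> int" where
  "qty R x i = (\<Sum>h\<in>units R. serves R x i h)"

definition qbar :: "('j, 't, 'h) rolling_data \<Rightarrow> 'j \<Rightarrow> int" where
  "qbar R i = Max (size_limit R ` trip_families R i)"

definition bigM :: "('j, 't, 'h) rolling_data \<Rightarrow> 'j \<Rightarrow> int" where
  "bigM R i = qbar R i"

definition bigM_cont :: "('j, 't, 'h) rolling_data \<Rightarrow> 'j \<Rightarrow> 'j \<Rightarrow> int" where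
  "bigM_cont R i j = 2 * Max {qbar R i, qbar R j, 1}"

definition th_dom :: "('j, 't, 'h) rolling_data \<Rightarrow> ('j, 'h) thvar set" where
  "th_dom R = (\<Pi>\<^sub>E (i, h)\<in>trips R \<times> units R. {0..qbar R i})"

definition u_dom :: "('j, 't, 'h) rolling_data \<Rightarrow> ('j, 'h) uvar set" where
  "u_dom R = {(i, h1, h2). i \<in> trips R \<and> h1 \<in> units R \<and> h2 \<in> units R \<and> h1 \<noteq> h2} \<rightarrow>\<^sub>E {0, 1}"

definition order_linking ::
  "('j, 't, 'h) rolling_data \<Rightarrow> ('j, 'h) xvar \<Rightarrow> ('j, 'h) thvar \<Rightarrow> ('j, 'h) uvar \<Rightarrow> bool" where
  "order_linking R x \<theta> u \<longleftrightarrow> \<theta> \<in> th_dom R \<and> u \<in> u_dom R \<and>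
     (\<forall>i\<in>trips R. \<forall>h\<in>units R.
        serves R x i h \<le> \<theta> (i, h) \<and> \<theta> (i, h) \<le> qty R x i \<and>
        \<theta> (i, h) \<le> bigM R i * serves R x i h) \<and>
     (\<forall>i\<in>trips R. \<forall>h1\<in>units R. \<forall>h2\<in>units R. h1 \<noteq> h2 \<longrightarrow>
        1 - bigM R i * (1 - u (i, h1, h2))
            - bigM R i * (2 - serves R x i h1 - serves R x i h2)
          \<le> \<theta> (i, h1) - \<theta> (i, h2) \<and>
        \<theta> (i, h1) - \<theta> (i, h2)
          \<le> bigM R i * u (i, h1, h2) - 1
            + bigM R i * (2 - serves R x i h1 - serves R x i h2))"

fun inst_slack :: "('j, 'h) ordering_inst \<Rightarrow> ('j, 'h) xvar \<Rightarrow> int" where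
  "inst_slack (Coupling h1 h2 i1 i2 j) x =
     2 - x (h1, (Trip i1, Trip j)) - x (h2, (Trip i2, Trip j))"
| "inst_slack (Decoupling h1 h2 i j1 j2) x =
     2 - x (h1, (Trip i, Trip j1)) - x (h2, (Trip i, Trip j2))"
| "inst_slack (Continuation h1 h2 i j) x =
     2 - x (h1, (Trip i, Trip j)) - x (h2, (Trip i, Trip j))"

fun inst_holds ::
  "('j, 't, 'h) rolling_data \<Rightarrow> ('j, 'h) xvar \<Rightarrow> ('j, 'h) thvar \<Rightarrow> ('j, 'h) ordering_inst \<Rightarrow> bool"
where
  "inst_holds R x \<theta> (Coupling h1 h2 i1 i2 j) \<longleftrightarrow>
     (let D = inst_slack (Coupling h1 h2 i1 i2 j) x;
          c = of_int (dir R j * (dir R i1 + dir R i2)) * (arr_time R i1 - arr_time R i2)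
      in dir R j * (dir R i1 - dir R i2) * (\<theta> (j, h1) - \<theta> (j, h2)) \<ge> - 2 * qbar R j * D \<and>
         c * of_int (\<theta> (j, h1) - \<theta> (j, h2)) \<ge> - \<bar>c\<bar> * of_int (qbar R j) * of_int D)"
| "inst_holds R x \<theta> (Decoupling h1 h2 i j1 j2) \<longleftrightarrow>
     (let D = inst_slack (Decoupling h1 h2 i j1 j2) x;
          c = of_int (dir R i * (dir R j1 + dir R j2)) * (dep_time R j1 - dep_time R j2)
      in dir R i * (dir R j1 - dir R j2) * (\<theta> (i, h1) - \<theta> (i, h2)) \<le> 2 * qbar R i * D \<and>
         c * of_int (\<theta> (i, h1) - \<theta> (i, h2)) \<ge> - \<bar>c\<bar> * of_int (qbar R i) * of_int D)"
| "inst_holds R x \<theta> (Continuation h1 h2 i j) \<longleftrightarrow>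
     (let D = inst_slack (Continuation h1 h2 i j) x;
          e = (\<theta> (j, h1) - \<theta> (j, h2)) - dir R i * dir R j * (\<theta> (i, h1) - \<theta> (i, h2))
      in - bigM_cont R i j * D \<le> e \<and> e \<le> bigM_cont R i j * D)"

definition active_insts ::
  "('j, 't, 'h) rolling_data \<Rightarrow> ('j, 'h) xvar \<Rightarrow> ('j, 'h) ordering_inst set" where
  "active_insts R x = {k \<in> ordering_insts R. inst_slack k x = 0}"

definition full_feasible ::
  "('j, 't, 'h) rolling_data \<Rightarrow>
     (('j, 'h) xvar \<times> ('j, 't) yvar \<times> ('j, 'h) thvar \<times> ('j, 'h) uvar) set" where
  "full_feasible R = {(x, y, \<theta>, u). (x, y) \<in> network_feasible R \<and> order_linking R x \<theta> u \<and>
     (\<forall>k\<in>ordering_insts R. inst_holds R x \<theta> k)}"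

definition completions ::
  "('j, 't, 'h) rolling_data \<Rightarrow> ('j, 'h) xvar \<Rightarrow> (('j, 'h) thvar \<times> ('j, 'h) uvar) set" where
  "completions R x = {(\<theta>, u). order_linking R x \<theta> u \<and>
     (\<forall>k\<in>active_insts R x. inst_holds R x \<theta> k)}"

definition X_ord :: "('j, 't, 'h) rolling_data \<Rightarrow> ('j, 'h) xvar set" where
  "X_ord R = {x \<in> X_net R. completions R x \<noteq> {}}"

end

theory Submission
  imports Defs
begin

text \<open>
  The full formulation and a completion differ only in the inactive instances. Such an instance
  has slack at least \<open>1\<close>, while two positions at a trip \<open>i\<close> differ by at most \<open>qbar R i\<close>, so the
  Big-\<open>M\<close> constants make its constraints redundant.
\<close>

text \<open>Two points of an interval of length \<open>Q\<close> are at most \<open>Q\<close> apart,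
  and a factor \<open>D\<close> of at least 1 only weakens this bound. The type is general because
  direction terms live in \<open>int\<close> and time-weighted terms in \<open>real\<close>.\<close>

lemma abs_mult_diff_le:
  fixes c p q Q D :: "'a::linordered_idom"
  assumes "p \<in> {0..Q}" "q \<in> {0..Q}" "1 \<le> D"
  shows "\<bar>c * (p - q)\<bar> \<le> \<bar>c\<bar> * Q * D"
proof -
  have "\<bar>p - q\<bar> \<le> Q" and "0 \<le> Q"
    using assms by (auto simp: abs_le_iff algebra_simps add_increasing add_increasing2)
  moreover from \<open>0 \<le> Q\<close> have "Q * 1 \<le> Q * D"
    using assms(3) by (intro mult_left_mono)
  ultimately have "\<bar>p - q\<bar> \<le> Q * D"
    by simp
  then have "\<bar>c\<bar> * \<bar>p - q\<bar> \<le> \<bar>c\<bar> * (Q * D)"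
    by (intro mult_left_mono) auto
  then show ?thesis
    by (simp add: abs_mult mult.assoc)
qed

text \<open>Each of the two arc variables is at most 1. As slacks are integers, an inactive instance
  then has slack at least 1, the threshold from which the Big-M bounds take effect.\<close>

lemma inst_slack_nonneg:
  assumes "x \<in> x_dom R" "admissible_inst R k"
  shows "0 \<le> inst_slack k x"
proof -
  have "x (h, a) \<le> 1" if "h \<in> units R" "a \<in> unit_arcs R h" for h a
    using PiE_mem[OF assms(1)[unfolded x_dom_def], of "(h, a)"] that by auto
  then have "x (h1, (Trip i1, Trip j1)) + x (h2, (Trip i2, Trip j2)) \<le> 1 + 1"
    if "h1 \<in> units R" "h2 \<in> units R" "unit_turn R h1 i1 j1" "unit_turn R h2 i2 j2"
    for h1 h2 i1 i2 j1 j2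
    using that by (intro add_mono) (auto simp: unit_turn_def)
  then show ?thesis
    using assms(2) by (cases k) (simp_all add: algebra_simps)
qed

lemma unit_turn_tripsD:
  assumes "valid_data R" "unit_turn R h i j"
  shows "i \<in> trips R" "j \<in> trips R"
  using assms by (auto simp: valid_data_def unit_turn_def)

lemma valid_data_abs_dir:
  assumes "valid_data R" "i \<in> trips R"
  shows "\<bar>dir R i\<bar> = 1"
  using assms by (auto simp: valid_data_def)

text \<open>Directions are signs, so their difference has modulus at most 2: this is the 2 in the
  coupling and decoupling bounds.\<close>

lemma abs_dir_mult_diff_le:
  assumes "valid_data R" "i \<in> trips R" "j \<in> trips R" "k \<in> trips R"
  shows "\<bar>dir R i * (dir R j - dir R k)\<bar> \<le> 2"
  using valid_data_abs_dir[OF assms(1)] assms(2-4)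
    abs_triangle_ineq4[of "dir R j" "dir R k"] by (simp add: abs_mult)

lemma inst_holds_if_slack_ge_1:
  assumes R: "valid_data R" and th: "\<theta> \<in> th_dom R"
    and adm: "admissible_inst R k" and slack: "1 \<le> inst_slack k x"
  shows "inst_holds R x \<theta> k"
proof -
  have bnd: "\<theta> (i, h) \<in> {0..qbar R i}" if "i \<in> trips R" "h \<in> units R" for i h
    using PiE_mem[OF th[unfolded th_dom_def], of "(i, h)"] that by auto
  \<comment> \<open>For same-direction constraints, where the Big-M constant itself contains
    \<open>\<bar>c\<bar>\<close>, so \<open>c\<close> may be arbitrary.\<close>
  have real_bound: "- \<bar>c\<bar> * of_int (qbar R i) * of_int D \<le> c * of_int (\<theta> (i, h1) - \<theta> (i, h2))"
    if "i \<in> trips R" "h1 \<in> units R" "h2 \<in> units R" "1 \<le> D" for c :: real and i h1 h2 D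
    using abs_mult_diff_le[of "real_of_int (\<theta> (i, h1))" "of_int (qbar R i)"
        "of_int (\<theta> (i, h2))" "of_int D" c] bnd[of i h1] bnd[of i h2] that
    by (simp add: abs_le_iff)
  \<comment> \<open>For opposite-direction constraints. The bound is two-sided because coupling
    needs the lower and decoupling the upper half.\<close>
  have int_bound: "\<bar>c * (\<theta> (i, h1) - \<theta> (i, h2))\<bar> \<le> 2 * qbar R i * D"
    if "i \<in> trips R" "h1 \<in> units R" "h2 \<in> units R" "1 \<le> D" "\<bar>c\<bar> \<le> 2" for c i h1 h2 D
  proof -
    \<comment> \<open>The interval \<open>{0..qbar R i}\<close> contains a position, so it is
      nonempty.\<close>
    have "0 \<le> qbar R i"
      using bnd[OF that(1,2)] by simp
    then have "\<bar>c\<bar> * qbar R i * D \<le> 2 * qbar R i * D"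
      using that by (intro mult_right_mono) auto
    with abs_mult_diff_le[OF bnd bnd, of i h1 h2 D c] that show ?thesis
      by linarith
  qed
  show ?thesis
  proof (cases k)
    case (Coupling h1 h2 i1 i2 j)
    with adm unit_turn_tripsD[OF R]
    have *: "h1 \<in> units R" "h2 \<in> units R" "i1 \<in> trips R" "i2 \<in> trips R" "j \<in> trips R"
      by auto
    show ?thesis
      using int_bound[OF *(5,1,2) slack abs_dir_mult_diff_le[OF R *(5,3,4)]]
        real_bound[OF *(5,1,2) slack]
      unfolding Coupling inst_holds.simps Let_def by (simp add: abs_le_iff)
  next
    case (Decoupling h1 h2 i j1 j2)
    with adm unit_turn_tripsD[OF R]
    have *: "h1 \<in> units R" "h2 \<in> units R" "j1 \<in> trips R" "j2 \<in> trips R" "i \<in> trips R"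
      by auto
    show ?thesis
      using int_bound[OF *(5,1,2) slack abs_dir_mult_diff_le[OF R *(5,3,4)]]
        real_bound[OF *(5,1,2) slack]
      unfolding Decoupling inst_holds.simps Let_def by (simp add: abs_le_iff)
  next
    case (Continuation h1 h2 i j)
    with adm unit_turn_tripsD[OF R]
    have *: "h1 \<in> units R" "h2 \<in> units R" "i \<in> trips R" "j \<in> trips R"
      by auto
    let ?D = "inst_slack k x"
    \<comment> \<open>The sign leaves the modulus of the difference at \<open>i\<close> unchanged,
      so the differences at \<open>i\<close> and \<open>j\<close> are bounded separately and then
      combined.\<close>
    have "\<bar>dir R i * dir R j\<bar> = 1"
      using valid_data_abs_dir[OF R] * by (simp add: abs_mult)
    then have "\<bar>dir R i * dir R j * (\<theta> (i, h1) - \<theta> (i, h2))\<bar> \<le> qbar R i * ?D"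
      using abs_mult_diff_le[OF bnd bnd slack, of i h1 h2 "dir R i * dir R j"] * by simp
    moreover have "\<bar>\<theta> (j, h1) - \<theta> (j, h2)\<bar> \<le> qbar R j * ?D"
      using abs_mult_diff_le[OF bnd bnd slack, of j h1 h2 1] * by simp
    \<comment> \<open>The maximum dominates both \<open>qbar\<close> values, hence the factor 2 in
      \<open>bigM_cont\<close>.\<close>
    moreover have "qbar R i * ?D + qbar R j * ?D \<le> bigM_cont R i j * ?D"
      unfolding distrib_right[symmetric] bigM_cont_def using slack
      by (intro mult_right_mono) auto
    ultimately show ?thesis
      unfolding Continuation inst_holds.simps Let_def by linarith
  qed
qed

text \<open>The variables \<open>y\<close> occur only in the network constraints, and
  \<open>\<theta>\<close>, \<open>u\<close> only in the others. For fixed \<open>x\<close> the two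
  choices are therefore independent, which yields both the projection identity and the pointwise
  criterion.\<close>

lemma full_feasible_iff_completions:
  assumes "valid_data R"
  shows "(x, y, \<theta>, u) \<in> full_feasible R \<longleftrightarrow>
    (x, y) \<in> network_feasible R \<and> (\<theta>, u) \<in> completions R x"
proof -
  have "inst_holds R x \<theta> k"
    if "(x, y) \<in> network_feasible R" "order_linking R x \<theta> u"
      "\<forall>k\<in>active_insts R x. inst_holds R x \<theta> k" "k \<in> ordering_insts R" for k
  proof (cases "inst_slack k x = 0")
    case True
    with that show ?thesis
      by (simp add: active_insts_def)
  next
    case False
    have "admissible_inst R k" "x \<in> x_dom R" "\<theta> \<in> th_dom R"
      using that by (auto simp: ordering_insts_def network_feasible_def order_linking_def)
    with False inst_slack_nonneg[of x R k] assms show ?thesis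
      by (intro inst_holds_if_slack_ge_1) auto
  qed
  then show ?thesis
    by (auto simp: full_feasible_def completions_def active_insts_def)
qed

theorem proposition4p7:
  fixes R :: "('j, 't, 'h) rolling_data"
  assumes "valid_data R"
  shows "fst ` full_feasible R = X_ord R \<and>
    (\<forall>x\<in>X_net R.
       (\<exists>y \<theta> u. (x, y, \<theta>, u) \<in> full_feasible R) \<longleftrightarrow> completions R x \<noteq> {})"
proof -
  have X_net: "x \<in> X_net R \<longleftrightarrow> (\<exists>y. (x, y) \<in> network_feasible R)" for x
    by (force simp: X_net_def)
  have "x \<in> fst ` full_feasible R \<longleftrightarrow> (\<exists>y \<theta> u. (x, y, \<theta>, u) \<in> full_feasible R)" for x
    by force
  then show ?thesis
    unfolding X_ord_def by (auto simp: full_feasible_iff_completions[OF assms] X_net)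
qed

end
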